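(* For all $p>1$ and $1<q\le\frac{2p}{p+1}$, the semidiscrete problem $$\frac{du_j}{dt}(t)-\delta_x^2u_j(t)+b_j|\delta_xu_j(t)|^q=|u_j(t)|^p\ (1\le j\le N),\quad u_j(0)=u_j^0\ge 0\ (1\le j\le N),\quad u_0(t)=u_{N+1}(t)=0,$$ has a unique maximal solution $U_h=(u_0,\dots,u_{N+1})\in C^1((0,T_h^* ),\mathbb{R}^{N+2})$.
   Context: $b$ is a continuous, positive and bounded function, $b_\infty=\|b\|_\infty$, and $b_j$ is the approximation of $b(x_j)$ (so $0<b_j\le b_\infty$). For a mesh size $h>0$, $N=\lfloor 2/h\rfloor+1$ and $x_j=-1+jh$ for $0\le j\le N+1$. Difference operators: $\delta_x^2u_j=\frac{u_{j+1}-2u_j+u_{j-1}}{h^2}$, $\delta_xu_j=\frac{u_{j+1}-u_{j-1}}{2h}$. $(0,T_h^* )$ is the maximal time interval on which $\|U_h(t)\|_\infty=\max_{0\le j\le N+1}|u_j(t)|<\infty$ ($T_h^*$ may be $+\infty$); the initial condition is attained continuously at $t=0$. *)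

theory Defs
  imports "HOL-Analysis.Analysis"
begin

definition num_nodes :: "real \<Rightarrow> nat" where
  "num_nodes h = nat \<lfloor>2 / h\<rfloor> + 1"

text \<open>
  A vector of \<open>\<real>\<^sup>N\<^sup>+\<^sup>2\<close>, where \<open>N = num_nodes h\<close> depends on the mesh size, is a function
  \<open>v :: nat \<Rightarrow> real\<close> of which only the values at \<open>j \<le> N + 1\<close> matter. The difference operators are
  only used at interior indices \<open>1 \<le> j \<le> N\<close>, so the subtraction \<open>j - 1\<close> does not truncate.
\<close>

definition delta_xx :: "real \<Rightarrow> (nat \<Rightarrow> real) \<Rightarrow> nat \<Rightarrow> real" where
  "delta_xx h v j = (v (j + 1) - 2 * v j + v (j - 1)) / h\<^sup>2"

definition delta_x :: "real \<Rightarrow> (nat \<Rightarrow> real) \<Rightarrow> nat \<Rightarrow> real" where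
  "delta_x h v j = (v (j + 1) - v (j - 1)) / (2 * h)"

definition grid_norm :: "real \<Rightarrow> (nat \<Rightarrow> real) \<Rightarrow> real" where
  "grid_norm h v = Max ((\<lambda>j. \<bar>v j\<bar>) ` {0..num_nodes h + 1})"

definition sup_norm :: "(real \<Rightarrow> real) \<Rightarrow> real" where
  "sup_norm b = (SUP x. \<bar>b x\<bar>)"

text \<open>
  Solutions live on \<open>[0, T)\<close> with \<open>0 < T \<le> \<infinity>\<close>: they are \<open>C\<^sup>1\<close> on the open interval
  \<open>einterval 0 T = {t. 0 < t \<and> t < T}\<close> and take the initial value continuously at \<open>0\<close>. The values
  of \<open>U\<close> at times outside \<open>[0, T)\<close> are irrelevant.
\<close>

definition semidiscrete_solution ::
  "real \<Rightarrow> real \<Rightarrow> real \<Rightarrow> (nat \<Rightarrow> real) \<Rightarrow> (nat \<Rightarrow> real) \<Rightarrow> ereal \<Rightarrow> (real \<Rightarrow> nat \<Rightarrow> real) \<Rightarrow> bool" where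
  "semidiscrete_solution p q h bh u0 T U \<longleftrightarrow>
     0 < T \<and>
     (\<forall>j \<le> num_nodes h + 1. (\<lambda>t. U t j) C1_differentiable_on einterval 0 T) \<and>
     (\<forall>t \<in> einterval 0 T. \<forall>j \<in> {1..num_nodes h}.
        deriv (\<lambda>s. U s j) t - delta_xx h (U t) j + bh j * \<bar>delta_x h (U t) j\<bar> powr q
          = \<bar>U t j\<bar> powr p) \<and>
     (\<forall>j \<in> {1..num_nodes h}. U 0 j = u0 j) \<and>
     (\<forall>j \<le> num_nodes h + 1. ((\<lambda>t. U t j) \<longlongrightarrow> U 0 j) (at_right 0)) \<and>
     (\<forall>t. 0 \<le> t \<and> ereal t < T \<longrightarrow> U t 0 = 0 \<and> U t (num_nodes h + 1) = 0)"

definition agree_on ::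
  "real \<Rightarrow> ereal \<Rightarrow> (real \<Rightarrow> nat \<Rightarrow> real) \<Rightarrow> (real \<Rightarrow> nat \<Rightarrow> real) \<Rightarrow> bool" where
  "agree_on h T U V \<longleftrightarrow> (\<forall>t. 0 \<le> t \<and> ereal t < T \<longrightarrow> (\<forall>j \<le> num_nodes h + 1. U t j = V t j))"

definition maximal_solution ::
  "real \<Rightarrow> real \<Rightarrow> real \<Rightarrow> (nat \<Rightarrow> real) \<Rightarrow> (nat \<Rightarrow> real) \<Rightarrow> ereal \<Rightarrow> (real \<Rightarrow> nat \<Rightarrow> real) \<Rightarrow> bool" where
  "maximal_solution p q h bh u0 T U \<longleftrightarrow>
     semidiscrete_solution p q h bh u0 T U \<and>
     \<not> (\<exists>T' V. T < T' \<and> semidiscrete_solution p q h bh u0 T' V \<and> agree_on h T U V)"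

end

theory Submission
  imports Defs "HOL-Probability.Discrete_Topology"
begin

text \<open>
  The right-hand side is Lipschitz on bounded sets because \<open>p, q > 1\<close>. Composing a field
  with the radial retraction onto a ball makes it globally Lipschitz, and the truncated equation is
  solved for all times at once by a contraction on bounded functions with weight \<open>exp (K * t)\<close>.
  The maximal time is the supremum of the existence times of all solutions. If the norm did not tend
  to infinity at a finite maximal time, the solution would be bounded, hence equal to that of a
  truncated equation with a larger radius, which continues past this time.

  Since the number of nodes depends on \<open>h\<close>, the phase space is the Banach space of bounded sequences
  instead of a space whose dimension is a type.
\<close>

section \<open>Differential equations in Banach spaces\<close>

text \<open>Mean value inequality against the primitive \<open>C / K * exp (K * t)\<close>. The
  factor \<open>1 / K\<close> gained by integration is what makes the Picard map contract in the
  weighted norm once \<open>K\<close> is large.\<close>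

lemma norm_integral_exp_bound:
  fixes g :: "real \<Rightarrow> 'a::banach"
  assumes g: "continuous_on UNIV g" and K: "K > 0" and t: "t \<ge> 0"
    and bound: "\<And>s. s \<ge> 0 \<Longrightarrow> norm (g s) \<le> C * exp (K * s)"
  shows "norm (integral {0..t} g) \<le> C / K * exp (K * t)"
proof -
  have "C \<ge> 0"
    using order_trans[OF norm_ge_zero bound[of 0]] by simp
  show ?thesis
  proof (cases "t = 0")
    case True
    then show ?thesis using \<open>C \<ge> 0\<close> K by simp
  next
    case False
    with t have "0 < t" by simp
    let ?I = "\<lambda>u. integral {0..u} g" and ?\<phi> = "\<lambda>u. C / K * exp (K * u)"
    have g0: "continuous_on {0..t} g" using g continuous_on_subset by blast
    have "norm (?I t - ?I 0) \<le> ?\<phi> t - ?\<phi> 0"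
    proof (rule differentiable_bound_general[OF \<open>0 < t\<close>])
      show "continuous_on {0..t} ?I"
        by (intro indefinite_integral_continuous_1 integrable_continuous_real g0)
      show "continuous_on {0..t} ?\<phi>"
        by (intro continuous_intros)
      fix x assume x: "0 < x" "x < t"
      show "(?I has_vector_derivative g x) (at x)"
        using integral_has_vector_derivative[OF g0, of x] x
        by (simp add: at_within_Icc_at)
      show "(?\<phi> has_vector_derivative C * exp (K * x)) (at x)"
        using K unfolding has_real_derivative_iff_has_vector_derivative[symmetric]
        by (auto intro!: derivative_eq_intros)
      show "norm (g x) \<le> C * exp (K * x)"
        using bound x by simp
    qed
    moreover have "0 \<le> ?\<phi> 0" using \<open>C \<ge> 0\<close> K by simp
    ultimately show ?thesis by simp
  qed
qed

text \<open>Bounded continuous functions live on the whole line, so the Picard integral is frozen at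
  \<open>0\<close> for negative times. Continuity is shown on each half-line \<open>{..<b}\<close>
  and glued over the open cover.\<close>

lemma continuous_indefinite_integral_max:
  fixes g :: "real \<Rightarrow> 'a::banach"
  assumes g: "continuous_on UNIV g"
  shows "continuous_on UNIV (\<lambda>t. integral {0..max 0 t} g)"
proof -
  have "continuous_on {..<b} (\<lambda>t. integral {0..max 0 t} g)" if "b \<in> UNIV" for b :: real
  proof (rule continuous_on_compose2[of "{0..max 0 b}" "\<lambda>t. integral {0..t} g" _ "max 0"])
    show "continuous_on {0..max 0 b} (\<lambda>t. integral {0..t} g)"
      by (intro indefinite_integral_continuous_1 integrable_continuous_real continuous_on_subset[OF g]) simp
    show "continuous_on {..<b} (max 0)" by (intro continuous_intros)
  qed auto
  then have "continuous_on (\<Union>b. {..<b}) (\<lambda>t. integral {0..max 0 t} g)"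
    by (intro continuous_on_open_UN) auto
  also have "(\<Union>b::real. {..<b}) = UNIV"
    using gt_ex by auto
  finally show ?thesis .
qed

text \<open>The unknown is not the solution but its rescaling by
  \<open>exp (- (K * \<bar>t\<bar>))\<close>, a bounded function. In the sup norm of the rescaled
  functions the Picard map is a contraction on the whole line, so no short-time steps have to be
  glued.\<close>

lemma global_lipschitz_ode:
  fixes G :: "'a::banach \<Rightarrow> 'a"
  assumes G: "L-lipschitz_on UNIV G"
  shows "\<exists>x. x 0 = x0 \<and> continuous_on UNIV x \<and>
    (\<forall>t>0. (x has_vector_derivative G (x t)) (at t))"
proof -
  \<comment> \<open>This choice gives the contraction factor \<open>L / K \<le> 1 / 2\<close>; the
    \<open>+ 1\<close> keeps \<open>K\<close> positive when \<open>L = 0\<close>.\<close>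
  define K where "K = 2 * (L + 1)"
  have L: "L \<ge> 0" using G lipschitz_on_nonneg by blast
  then have K: "K > 0" and LK: "L / K \<le> 1 / 2" by (auto simp: K_def field_simps)
  \<comment> \<open>\<open>u w\<close> undoes the weight, \<open>I w\<close> is the Picard integral
    along \<open>u w\<close>, and \<open>f w\<close> is the Picard image with the weight put
    back.\<close>
  define u where "u w s = exp (K * \<bar>s\<bar>) *\<^sub>R apply_bcontfun w s" for w :: "real \<Rightarrow>\<^sub>C 'a" and s
  define I where "I w t = integral {0..max 0 t} (\<lambda>s. G (u w s))" for w t
  define f where "f w t = exp (- (K * \<bar>t\<bar>)) *\<^sub>R (x0 + I w t)" for w t
  have contG: "continuous_on A G" for A
    using lipschitz_on_continuous_on[OF G] continuous_on_subset by blast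
  have contu: "continuous_on UNIV (u w)" for w
    unfolding u_def by (intro continuous_intros) auto
  have contGu: "continuous_on UNIV (\<lambda>s. G (u w s))" for w
    by (rule continuous_on_compose2[OF contG contu]) auto
  have contI: "continuous_on UNIV (I w)" for w
    unfolding I_def by (rule continuous_indefinite_integral_max[OF contGu])
  have le_dist: "norm (G (u v s) - G (u w s)) \<le> L * dist v w * exp (K * s)" if "s \<ge> 0" for v w s
  proof -
    have "norm (G (u v s) - G (u w s)) \<le> L * norm (u v s - u w s)"
      using lipschitz_on_normD[OF G] by simp
    also have "norm (u v s - u w s) = exp (K * s) * dist (apply_bcontfun v s) (apply_bcontfun w s)"
      using that by (simp add: u_def dist_norm flip: scaleR_diff_right)
    also have "L * \<dots> \<le> L * (exp (K * s) * dist v w)"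
      using L by (intro mult_left_mono dist_bounded) auto
    finally show ?thesis by (simp add: mult_ac)
  qed
  have exp_le: "norm (exp (- (K * \<bar>t\<bar>)) *\<^sub>R y) \<le> C" if "norm y \<le> C * exp (K * \<bar>t\<bar>)" for t C and y :: 'a
    using that by (simp add: exp_minus field_simps)
  have I_diff: "norm (I v t - I w t) \<le> (L * dist v w) / K * exp (K * \<bar>t\<bar>)" for v w t
  proof -
    have "I v t - I w t = integral {0..max 0 t} (\<lambda>s. G (u v s) - G (u w s))"
      unfolding I_def
      by (intro integral_diff[symmetric] integrable_continuous_real continuous_on_subset[OF contGu]) auto
    also have "norm \<dots> \<le> (L * dist v w) / K * exp (K * max 0 t)"
      using le_dist by (intro norm_integral_exp_bound K continuous_on_diff contGu) auto
    also have "\<dots> \<le> (L * dist v w) / K * exp (K * \<bar>t\<bar>)"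
      using L K by (intro mult_left_mono) auto
    finally show ?thesis .
  qed
  have I_bound: "norm (I w t) \<le> (norm (G 0) + L * norm w) / K * exp (K * \<bar>t\<bar>)" for w t
  proof -
    have "norm (I w t) \<le> (norm (G 0) + L * norm w) / K * exp (K * max 0 t)"
      unfolding I_def
    proof (intro norm_integral_exp_bound K contGu)
      fix s :: real assume "0 \<le> s"
      then have "norm (G (u w s) - G 0) \<le> L * norm w * exp (K * s)"
        using le_dist[of s w 0] by (simp add: u_def dist_norm)
      moreover have "norm (G 0) * 1 \<le> norm (G 0) * exp (K * s)"
        using K \<open>0 \<le> s\<close> by (intro mult_left_mono) auto
      moreover have "norm (G (u w s)) \<le> norm (G (u w s) - G 0) + norm (G 0)"
        by (metis diff_add_cancel norm_triangle_ineq)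
      ultimately show "norm (G (u w s)) \<le> (norm (G 0) + L * norm w) * exp (K * s)"
        by (simp add: distrib_right)
    qed simp
    also have "\<dots> \<le> (norm (G 0) + L * norm w) / K * exp (K * \<bar>t\<bar>)"
      using L K by (intro mult_left_mono) auto
    finally show ?thesis .
  qed
  \<comment> \<open>The Lipschitz bound gives \<open>G\<close> at most linear growth, so the Picard
    image grows no faster than the weight and \<open>f\<close> maps the space to itself.\<close>
  have f_bcontfun: "f w \<in> bcontfun" for w
  proof (rule bcontfun_normI)
    show "continuous_on UNIV (f w)"
      unfolding f_def by (intro continuous_intros contI)
    fix t
    have "norm x0 * 1 \<le> norm x0 * exp (K * \<bar>t\<bar>)"
      using K by (intro mult_left_mono) auto
    then have "norm (x0 + I w t) \<le> (norm x0 + (norm (G 0) + L * norm w) / K) * exp (K * \<bar>t\<bar>)"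
      using norm_triangle_ineq[of x0 "I w t"] I_bound[of w t] by (simp add: distrib_right)
    then show "norm (f w t) \<le> norm x0 + (norm (G 0) + L * norm w) / K"
      unfolding f_def by (rule exp_le)
  qed
  define P where "P w = Bcontfun (f w)" for w
  have apply_P: "apply_bcontfun (P w) = f w" for w
    using f_bcontfun by (simp add: P_def Bcontfun_inverse)
  have "dist (P v) (P w) \<le> 1 / 2 * dist v w" for v w
  proof (rule dist_bound)
    fix t
    have "f v t - f w t = exp (- (K * \<bar>t\<bar>)) *\<^sub>R (I v t - I w t)"
      by (simp add: f_def algebra_simps)
    then have "dist (f v t) (f w t) \<le> (L * dist v w) / K"
      using exp_le[OF I_diff[of v t w]] by (simp only: dist_norm)
    also have "\<dots> = L / K * dist v w" by simp
    also have "\<dots> \<le> 1 / 2 * dist v w"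
      by (intro mult_right_mono LK) auto
    finally show "dist (apply_bcontfun (P v) t) (apply_bcontfun (P w) t) \<le> 1 / 2 * dist v w"
      by (simp add: apply_P)
  qed
  then have "\<exists>!w. P w = w"
    by (intro banach_fix_type[of "1/2"]) auto
  then obtain w where "P w = w" by blast
  \<comment> \<open>Cancelling the weight in the fixed point equation leaves the integral equation;
    for negative \<open>t\<close> it makes the solution constantly \<open>x0\<close>.\<close>
  then have u_eq: "u w t = x0 + I w t" for t
    using apply_P[of w] by (simp add: u_def f_def exp_minus flip: scaleR_add_right)
  show ?thesis
  proof (intro exI[of _ "u w"] conjI allI impI)
    show "u w 0 = x0" using u_eq[of 0] by (simp add: I_def)
    show "continuous_on UNIV (u w)" by (rule contu)
    fix t :: real assume t: "t > 0"
    have "((\<lambda>r. integral {0..r} (\<lambda>s. G (u w s))) has_vector_derivative G (u w t)) (at t within {0..t + 1})"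
      using t by (intro integral_has_vector_derivative continuous_on_subset[OF contGu]) auto
    then have "((\<lambda>r. x0 + integral {0..r} (\<lambda>s. G (u w s))) has_vector_derivative G (u w t)) (at t)"
      using t by (simp add: at_within_Icc_at has_vector_derivative_add_const add.commute[of x0])
    then show "(u w has_vector_derivative G (u w t)) (at t)"
    proof (rule has_vector_derivative_transform_within_open[of _ _ _ "{0<..}"])
      fix r :: real assume "r \<in> {0<..}"
      then show "x0 + integral {0..r} (\<lambda>s. G (u w s)) = u w r"
        unfolding u_eq[of r] I_def by simp
    qed (use t in auto)
  qed
qed


section \<open>Uniqueness on a compact interval\<close>

text \<open>Let the weighted distance \<open>?w\<close> attain its maximum \<open>m\<close> at
  \<open>c\<close>. Integrating the Lipschitz bound up to \<open>c\<close> bounds the distance there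
  by half of \<open>m * exp (2 * L * c)\<close>, its actual value, so \<open>m\<close> must vanish.
  The weight with \<open>2 * L\<close> takes the place of Gronwall's inequality.\<close>

lemma ode_unique_interval:
  fixes x y :: "real \<Rightarrow> 'a::real_normed_vector"
  assumes F: "L-lipschitz_on S F"
    and x: "continuous_on {0..a} x" "\<And>t. 0 < t \<Longrightarrow> t < a \<Longrightarrow> (x has_vector_derivative F (x t)) (at t)"
    and y: "continuous_on {0..a} y" "\<And>t. 0 < t \<Longrightarrow> t < a \<Longrightarrow> (y has_vector_derivative F (y t)) (at t)"
    and S: "\<And>t. 0 < t \<Longrightarrow> t < a \<Longrightarrow> x t \<in> S \<and> y t \<in> S"
    and init: "x 0 = y 0" and t: "0 \<le> t" "t \<le> a"
  shows "x t = y t"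
proof -
  have L: "L \<ge> 0" using F by (rule lipschitz_on_nonneg)
  let ?d = "\<lambda>s. x s - y s"
  let ?w = "\<lambda>s. exp (- (2 * L * s)) * norm (?d s)"
  have "continuous_on {0..a} ?w"
    by (intro continuous_intros x y)
  then obtain c where c: "0 \<le> c" "c \<le> a" and max: "\<And>s. 0 \<le> s \<Longrightarrow> s \<le> a \<Longrightarrow> ?w s \<le> ?w c"
    using continuous_attains_sup[of "{0..a}" ?w] t by auto
  define m where "m = ?w c"
  have d_le: "norm (?d s) \<le> m * exp (2 * L * s)" if "0 \<le> s" "s \<le> a" for s
    using max[OF that] by (simp add: m_def exp_minus field_simps)
  have d_c: "norm (?d c) = m * exp (2 * L * c)"
    by (simp add: m_def exp_minus field_simps)
  have "m \<le> 0"
  proof (cases "c = 0")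
    case True
    then show ?thesis using init by (simp add: m_def)
  next
    case False
    with c have c0: "0 < c" by simp
    \<comment> \<open>A primitive of \<open>L * (m * exp (2 * L * s))\<close> written without
      division by \<open>L\<close>, so that \<open>L = 0\<close> is no special case.\<close>
    let ?\<phi> = "\<lambda>s. m / 2 * exp (2 * L * s)"
    have "norm (?d c - ?d 0) \<le> ?\<phi> c - ?\<phi> 0"
    proof (rule differentiable_bound_general[OF c0])
      show "continuous_on {0..c} ?d"
        using c by (intro continuous_on_diff continuous_on_subset[OF x(1)] continuous_on_subset[OF y(1)]) auto
      show "continuous_on {0..c} ?\<phi>" by (intro continuous_intros)
      fix s assume s: "0 < s" "s < c"
      then have s': "0 < s" "s < a" using c by auto
      show "(?d has_vector_derivative F (x s) - F (y s)) (at s)"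
        by (intro has_vector_derivative_diff x(2) y(2) s')
      show "(?\<phi> has_vector_derivative L * (m * exp (2 * L * s))) (at s)"
        unfolding has_real_derivative_iff_has_vector_derivative[symmetric]
        by (auto intro!: derivative_eq_intros)
      have "norm (F (x s) - F (y s)) \<le> L * norm (?d s)"
        using lipschitz_on_normD[OF F] S[OF s'] by blast
      also have "\<dots> \<le> L * (m * exp (2 * L * s))"
        using d_le[of s] s' L by (intro mult_left_mono) auto
      finally show "norm (F (x s) - F (y s)) \<le> L * (m * exp (2 * L * s))" .
    qed
    then have "m * exp (2 * L * c) \<le> m / 2 * exp (2 * L * c) - m / 2"
      using init d_c by simp
    moreover have "0 \<le> m" by (simp add: m_def)
    ultimately have "m * exp (2 * L * c) \<le> 0"
      by (simp add: field_simps)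
    then show ?thesis by (simp add: mult_le_0_iff)
  qed
  then have "m * exp (2 * L * t) \<le> 0" by (simp add: mult_le_0_iff)
  with d_le[OF t] have "norm (?d t) \<le> 0" by linarith
  then show ?thesis by simp
qed

section \<open>Truncation to a ball\<close>

text \<open>For \<open>R > 0\<close>, the identity on the closed ball and the projection along rays
  onto its sphere outside; \<open>max\<close> merges the two cases and keeps the denominator
  positive.\<close>

definition radial_retract :: "real \<Rightarrow> 'a::real_normed_vector \<Rightarrow> 'a" where
  "radial_retract R v = (R / max R (norm v)) *\<^sub>R v"

lemma radial_retract_id: "R > 0 \<Longrightarrow> norm v \<le> R \<Longrightarrow> radial_retract R v = v"
  by (simp add: radial_retract_def max_def)

lemma norm_radial_retract: "R > 0 \<Longrightarrow> norm (radial_retract R v) \<le> R"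
  by (auto simp: radial_retract_def max_def field_simps)

text \<open>Moving the vector at a fixed scale and changing the scale at a fixed vector each cost at
  most \<open>norm (v - w)\<close>, hence the constant 2. In a general normed space the retraction
  need not be nonexpansive.\<close>

lemma lipschitz_radial_retract:
  assumes R: "R > 0"
  shows "2-lipschitz_on S (radial_retract R)"
proof (rule lipschitz_onI)
  fix v w :: 'a
  define a where "a = max R (norm v)"
  define b where "b = max R (norm w)"
  have ab: "a > 0" "b > 0" "R \<le> a" "norm w \<le> b" using R by (auto simp: a_def b_def)
  have diff: "\<bar>b - a\<bar> \<le> norm (v - w)"
  proof -
    have "\<bar>b - a\<bar> \<le> \<bar>norm w - norm v\<bar>" by (simp add: a_def b_def max_def)
    also have "\<dots> \<le> norm (v - w)" by (metis norm_minus_commute norm_triangle_ineq3)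
    finally show ?thesis .
  qed
  have "radial_retract R v - radial_retract R w = (R / a) *\<^sub>R v - (R / b) *\<^sub>R w"
    by (simp add: radial_retract_def a_def b_def)
  also have "\<dots> = (R / a) *\<^sub>R (v - w) + (R / a - R / b) *\<^sub>R w"
    by (simp add: scaleR_diff_right scaleR_diff_left)
  \<comment> \<open>The change of scale carries the factor \<open>1 / b\<close>, which absorbs
    \<open>norm w\<close> because \<open>norm w \<le> b\<close>.\<close>
  also have "R / a - R / b = (R / a) * ((b - a) / b)"
    using ab by (simp add: diff_divide_distrib right_diff_distrib)
  finally have "norm (radial_retract R v - radial_retract R w)
      \<le> norm ((R / a) *\<^sub>R (v - w)) + norm (((R / a) * ((b - a) / b)) *\<^sub>R w)"
    by (simp only: norm_triangle_ineq)
  also have "norm ((R / a) *\<^sub>R (v - w)) \<le> 1 * norm (v - w)"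
    using R ab unfolding norm_scaleR by (intro mult_right_mono) auto
  also have "norm (((R / a) * ((b - a) / b)) *\<^sub>R w) = (R / a) * (norm w / b) * \<bar>b - a\<bar>"
    using R ab by (simp add: abs_mult)
  also have "\<dots> \<le> (1 * 1) * norm (v - w)"
    using R ab diff by (intro mult_mono) auto
  finally show "dist (radial_retract R v) (radial_retract R w) \<le> 2 * dist v w"
    by (simp add: dist_norm)
qed simp

lemma lipschitz_truncated:
  assumes F: "L-lipschitz_on (cball 0 R) F" and R: "R > 0"
  shows "(L * 2)-lipschitz_on UNIV (\<lambda>v. F (radial_retract R v))"
  using norm_radial_retract[OF R]
  by (intro lipschitz_on_compose2[OF lipschitz_radial_retract[OF R]] lipschitz_on_subset[OF F]) auto

section \<open>Local solutions, continuation and blow-up\<close>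

text \<open>In infinite dimensions this is stronger than being locally Lipschitz. It bounds the
  field on every bounded set, which the blow-up argument relies on.\<close>

definition lipschitz_on_balls :: "('a::real_normed_vector \<Rightarrow> 'b::real_normed_vector) \<Rightarrow> bool" where
  "lipschitz_on_balls f \<longleftrightarrow> (\<forall>R. \<exists>L. L-lipschitz_on (cball 0 R) f)"

definition ode_solution :: "('a::real_normed_vector \<Rightarrow> 'a) \<Rightarrow> 'a \<Rightarrow> ereal \<Rightarrow> (real \<Rightarrow> 'a) \<Rightarrow> bool" where
  "ode_solution F x0 T x \<longleftrightarrow> 0 < T \<and> x 0 = x0 \<and> (x \<longlongrightarrow> x0) (at_right 0) \<and>
     (\<forall>t. 0 < t \<and> ereal t < T \<longrightarrow> (x has_vector_derivative F (x t)) (at t))"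

lemma ode_solution_continuous:
  assumes x: "ode_solution F x0 T x" and a: "ereal a < T"
  shows "continuous_on {0..a} x"
  unfolding continuous_on_eq_continuous_within
proof
  fix t assume t: "t \<in> {0..a}"
  show "continuous (at t within {0..a}) x"
  proof (cases "t = 0")
    case True
    show ?thesis
    proof (cases "a = 0")
      case True
      then show ?thesis
        using t continuous_on_sing[of 0 x] by (simp add: continuous_on_eq_continuous_within)
    next
      case False
      then show ?thesis
        using \<open>t = 0\<close> x t by (auto simp: ode_solution_def continuous_within at_within_Icc_at_right)
    qed
  next
    case False
    then have "0 < t" "ereal t < T" using t a by (auto intro: le_less_trans[of _ "ereal a"])
    then have "(x has_vector_derivative F (x t)) (at t)"
      using x by (auto simp: ode_solution_def)
    then show ?thesis
      by (rule continuous_at_imp_continuous_at_within[OF has_vector_derivative_continuous])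
  qed
qed

text \<open>On the compact interval \<open>{0..t}\<close> both solutions are bounded, so one ball
  and one Lipschitz constant serve for both.\<close>

lemma ode_solution_unique:
  assumes F: "lipschitz_on_balls F"
    and x: "ode_solution F x0 T x" and y: "ode_solution F x0 T' y"
    and t: "0 \<le> t" "ereal t < T" "ereal t < T'"
  shows "x t = y t"
proof -
  have cx: "continuous_on {0..t} x" and cy: "continuous_on {0..t} y"
    using ode_solution_continuous[OF x t(2)] ode_solution_continuous[OF y t(3)] by auto
  then have "bounded (x ` {0..t} \<union> y ` {0..t})"
    by (simp add: compact_continuous_image compact_imp_bounded)
  then obtain R where R: "\<And>v. v \<in> x ` {0..t} \<union> y ` {0..t} \<Longrightarrow> norm v \<le> R"
    unfolding bounded_iff by blast
  obtain L where L: "L-lipschitz_on (cball 0 R) F"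
    using F by (auto simp: lipschitz_on_balls_def)
  show ?thesis
  proof (rule ode_unique_interval[OF L cx _ cy])
    show "x 0 = y 0" using x y by (simp add: ode_solution_def)
    fix s assume s: "0 < s" "s < t"
    then have "ereal s < T" "ereal s < T'"
      using t by (auto intro: less_trans[of _ "ereal t"])
    then show "(x has_vector_derivative F (x s)) (at s)" "(y has_vector_derivative F (y s)) (at s)"
      using x y s by (auto simp: ode_solution_def)
    show "x s \<in> cball 0 R \<and> y s \<in> cball 0 R"
      using s by (auto intro!: R)
  qed (use t in auto)
qed

text \<open>A global solution of the truncated equation solves the original one as long as it stays
  in the ball.\<close>

lemma ode_solution_exists:
  fixes F :: "'a::banach \<Rightarrow> 'a"
  assumes F: "lipschitz_on_balls F"
  obtains T x where "ode_solution F x0 T x"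
proof -
  \<comment> \<open>The margin 1 puts \<open>x0\<close> strictly inside the ball, so that the
    truncation stays inactive for a short time.\<close>
  define R where "R = norm x0 + 1"
  have R: "R > 0" by (simp add: R_def add_nonneg_pos)
  obtain L where L: "L-lipschitz_on (cball 0 R) F"
    using F by (auto simp: lipschitz_on_balls_def)
  obtain x where x: "x 0 = x0" "continuous_on UNIV x"
    "\<forall>t>0. (x has_vector_derivative F (radial_retract R (x t))) (at t)"
    using global_lipschitz_ode[OF lipschitz_truncated[OF L R], of x0] by blast
  have "open {t. norm (x t) < R}"
    using x(2) by (intro open_Collect_less continuous_intros) auto
  moreover have "0 \<in> {t. norm (x t) < R}" by (simp add: x R_def)
  ultimately obtain d where d: "d > 0" "ball 0 d \<subseteq> {t. norm (x t) < R}"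
    using openE by blast
  have "ode_solution F x0 (ereal d) x"
    unfolding ode_solution_def
  proof (intro conjI allI impI)
    have "isCont x 0" using x(2) continuous_on_eq_continuous_at by blast
    then show "(x \<longlongrightarrow> x0) (at_right 0)"
      using x(1) by (auto simp: isCont_def intro: tendsto_within_subset)
    fix t assume t: "0 < t \<and> ereal t < ereal d"
    then have "norm (x t) < R" using d by (auto simp: dist_norm subset_iff)
    then show "(x has_vector_derivative F (x t)) (at t)"
      using x(3)[rule_format, of t] t radial_retract_id[OF R, of "x t"] by simp
  qed (use d x in auto)
  then show ?thesis by (rule that)
qed

text \<open>A solution bounded by \<open>B\<close> coincides up to \<open>T\<close> with the global
  solution of the equation truncated at \<open>B + 1\<close>. By continuity the latter has norm at
  most \<open>B\<close> at \<open>T\<close>, so it stays where the truncation is inactive for some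
  time after \<open>T\<close>.\<close>

lemma ode_solution_extend:
  fixes F :: "'a::banach \<Rightarrow> 'a"
  assumes F: "lipschitz_on_balls F"
    and x: "ode_solution F x0 (ereal T) x" and bounded: "bounded (x ` {0..<T})"
  obtains T' y where "ereal T < T'" "ode_solution F x0 T' y"
proof -
  have T: "T > 0" using x by (simp add: ode_solution_def)
  obtain B where B: "B > 0" "\<And>t. 0 \<le> t \<Longrightarrow> t < T \<Longrightarrow> norm (x t) \<le> B"
    using bounded by (auto simp: bounded_pos)
  define R where "R = B + 1"
  have R: "R > 0" using B by (simp add: R_def)
  obtain L where L: "L-lipschitz_on (cball 0 R) F"
    using F by (auto simp: lipschitz_on_balls_def)
  let ?G = "\<lambda>v. F (radial_retract R v)"
  have G: "(L * 2)-lipschitz_on UNIV ?G" by (rule lipschitz_truncated[OF L R])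
  obtain y where y: "y 0 = x0" "continuous_on UNIV y"
      "\<forall>t>0. (y has_vector_derivative ?G (y t)) (at t)"
    using global_lipschitz_ode[OF G, of x0] by blast
  have y_eq: "y t = x t" if t: "0 \<le> t" "t < T" for t
  proof (rule ode_unique_interval[OF G, of t])
    show "continuous_on {0..t} y" using y(2) continuous_on_subset by blast
    show "continuous_on {0..t} x" using ode_solution_continuous[OF x] t by simp
    show "y 0 = x 0" using x y by (simp add: ode_solution_def)
    fix s assume s: "0 < s" "s < t"
    show "(y has_vector_derivative ?G (y s)) (at s)" using y(3) s by blast
    have "radial_retract R (x s) = x s"
      using B(2)[of s] s t by (intro radial_retract_id R) (auto simp: R_def)
    then show "(x has_vector_derivative ?G (x s)) (at s)"
      using x s t by (simp add: ode_solution_def)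
  qed (use t in auto)
  have "norm (y T) \<le> B"
  proof (rule tendsto_upperbound)
    have "isCont y T" using y(2) continuous_on_eq_continuous_at by blast
    then show "((\<lambda>t. norm (y t)) \<longlongrightarrow> norm (y T)) (at_left T)"
      by (auto simp: isCont_def intro!: tendsto_norm intro: tendsto_within_subset)
    have "eventually (\<lambda>t. t \<in> {0<..<T}) (at_left T)"
      using T by (rule eventually_at_left_real)
    then show "\<forall>\<^sub>F t in at_left T. norm (y t) \<le> B"
      by eventually_elim (use B y_eq in auto)
  qed simp
  then have "T \<in> {t. norm (y t) < R}" by (simp add: R_def)
  moreover have "open {t. norm (y t) < R}"
    using y(2) by (intro open_Collect_less continuous_intros) auto
  ultimately obtain d where d: "d > 0" "ball T d \<subseteq> {t. norm (y t) < R}"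
    using openE by blast
  have "ode_solution F x0 (ereal (T + d)) y"
    unfolding ode_solution_def
  proof (intro conjI allI impI)
    have "isCont y 0" using y(2) continuous_on_eq_continuous_at by blast
    then show "(y \<longlongrightarrow> x0) (at_right 0)"
      using y(1) by (auto simp: isCont_def intro: tendsto_within_subset)
    fix t assume t: "0 < t \<and> ereal t < ereal (T + d)"
    have "norm (y t) < R"
    proof (cases "t < T")
      case True
      then show ?thesis using y_eq[of t] B(2)[of t] t by (simp add: R_def)
    next
      case False
      then show ?thesis using d t by (auto simp: dist_norm subset_iff)
    qed
    then show "(y has_vector_derivative F (y t)) (at t)"
      using y(3)[rule_format, of t] t radial_retract_id[OF R, of "y t"] by simp
  qed (use d y T in auto)
  then show ?thesis using that[of "ereal (T + d)" y] d by simp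
qed

text \<open>Without divergence the norm falls below some \<open>R\<close> at times arbitrarily close
  to \<open>T\<close>. On the ball of radius \<open>R + 1\<close> the speed is at most
  \<open>M\<close>, so gaining one unit of norm takes at least \<open>1 / M\<close>. From a time
  \<open>a\<close> closer than that to \<open>T\<close>, the solution cannot leave the ball before
  \<open>T\<close>.\<close>

lemma ode_solution_bounded:
  fixes F :: "'a::real_normed_vector \<Rightarrow> 'a"
  assumes F: "lipschitz_on_balls F"
    and x: "ode_solution F x0 (ereal T) x"
    and not_top: "\<not> filterlim (\<lambda>t. norm (x t)) at_top (at_left T)"
  shows "bounded (x ` {0..<T})"
proof -
  have T: "T > 0" using x by (simp add: ode_solution_def)
  have x': "(x has_vector_derivative F (x t)) (at t)" if "0 < t" "t < T" for t
    using x that by (simp add: ode_solution_def)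
  obtain R where R: "\<exists>\<^sub>F t in at_left T. norm (x t) < R"
    using not_top by (auto simp: filterlim_at_top not_eventually not_le)
  obtain L where L: "L-lipschitz_on (cball 0 (\<bar>R\<bar> + 1)) F"
    using F by (auto simp: lipschitz_on_balls_def)
  then have "L \<ge> 0" by (rule lipschitz_on_nonneg)
  \<comment> \<open>Bounds the field on the ball through its value at \<open>0\<close>; the last
    summand makes \<open>M\<close> positive so that \<open>1 / M\<close> is usable.\<close>
  define M where "M = norm (F 0) + L * (\<bar>R\<bar> + 1) + 1"
  have M_pos: "M > 0"
    using \<open>L \<ge> 0\<close> by (simp add: M_def add_nonneg_pos)
  have M: "norm (F v) \<le> M" if "norm v \<le> R + 1" for v
  proof -
    have "norm (F v - F 0) \<le> L * norm (v - 0)"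
      using that by (intro lipschitz_on_normD[OF L]) auto
    also have "\<dots> \<le> L * (\<bar>R\<bar> + 1)"
      using that \<open>L \<ge> 0\<close> by (intro mult_left_mono) auto
    moreover have "norm (F v) \<le> norm (F v - F 0) + norm (F 0)"
      by (metis diff_add_cancel norm_triangle_ineq)
    ultimately show ?thesis by (simp add: M_def)
  qed
  have "eventually (\<lambda>t. t \<in> {max 0 (T - 1 / M)<..<T}) (at_left T)"
    using T M_pos by (intro eventually_at_left_real) auto
  from frequently_eventually_frequently[OF R this]
  obtain a where a: "norm (x a) < R" "0 < a" "T - 1 / M < a" "a < T"
    by (auto dest!: frequently_ex)
  have ca: "continuous_on {0..t} x" if "t < T" for t
    using ode_solution_continuous[OF x] that by simp
  have after: "norm (x t) < R + 1" if t: "a \<le> t" "t < T" for t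
  proof (rule ccontr)
    assume exceeds: "\<not> norm (x t) < R + 1"
    \<comment> \<open>The infimum of this compact set is the first time \<open>c\<close> after
      \<open>a\<close> at which the norm reaches \<open>R + 1\<close>; before it the speed bound
      holds.\<close>
    let ?S = "{s \<in> {a..t}. R + 1 \<le> norm (x s)}"
    have cx: "continuous_on {a..t} x"
      by (rule continuous_on_subset[OF ca[OF t(2)]]) (use a in auto)
    have "closed ?S" by (intro continuous_on_closed_Collect_le continuous_intros cx)
    moreover have "bounded ?S" by (rule bounded_subset[of "{a..t}"]) auto
    ultimately have "compact ?S" by (simp add: compact_eq_bounded_closed)
    moreover have "?S \<noteq> {}" using exceeds t by auto
    ultimately obtain c where c: "a \<le> c" "c \<le> t" "R + 1 \<le> norm (x c)"
      and first: "\<And>s. s \<in> ?S \<Longrightarrow> c \<le> s"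
      using compact_attains_inf[of ?S] by auto
    have "a < c" using a c by (cases "a = c") auto
    then have "norm (x c - x a) \<le> M * c - M * a"
    proof (rule differentiable_bound_general)
      show "continuous_on {a..c} x" using cx c by (auto elim: continuous_on_subset)
      show "continuous_on {a..c} ((*) M)" by (intro continuous_intros)
      fix s assume s: "a < s" "s < c"
      show "(x has_vector_derivative F (x s)) (at s)"
        using s a c t by (intro x') auto
      show "((*) M has_vector_derivative M) (at s)"
        unfolding has_real_derivative_iff_has_vector_derivative[symmetric]
        by (auto intro!: derivative_eq_intros)
      have "norm (x s) \<le> R + 1" using first[of s] s c by force
      then show "norm (F (x s)) \<le> M" by (rule M)
    qed
    also have "\<dots> = M * (c - a)" by (simp add: algebra_simps)
    also have "\<dots> < M * (1 / M)"
      using a c t M_pos by (intro mult_strict_left_mono) auto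
    finally have "norm (x c - x a) < 1" using M_pos by simp
    moreover have "norm (x c) \<le> norm (x c - x a) + norm (x a)"
      by (metis diff_add_cancel norm_triangle_ineq)
    ultimately show False using a c by simp
  qed
  have "bounded (x ` {0..a} \<union> cball 0 (R + 1))"
    using a ca by (simp add: compact_continuous_image compact_imp_bounded)
  moreover have "x ` {0..<T} \<subseteq> x ` {0..a} \<union> cball 0 (R + 1)"
  proof (rule image_subsetI)
    fix t assume "t \<in> {0..<T}"
    then show "x t \<in> x ` {0..a} \<union> cball 0 (R + 1)"
      using after[of t] by (cases "t \<le> a") auto
  qed
  ultimately show ?thesis by (rule bounded_subset)
qed

text \<open>All solutions are glued into one on the union of their intervals. The second clause
  makes every solution a restriction of it, from which uniqueness of maximal solutions follows; a
  bounded solution at a finite \<open>T\<close> would extend beyond the supremum.\<close>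

theorem ode_maximal_solution:
  fixes F :: "'a::banach \<Rightarrow> 'a"
  assumes F: "lipschitz_on_balls F"
  shows "\<exists>T x. ode_solution F x0 T x \<and>
    (\<forall>T' y. ode_solution F x0 T' y \<longrightarrow> T' \<le> T \<and> (\<forall>t. 0 \<le> t \<and> ereal t < T' \<longrightarrow> y t = x t)) \<and>
    (T < \<infinity> \<longrightarrow> filterlim (\<lambda>t. norm (x t)) at_top (at_left (real_of_ereal T)))"
proof -
  define T where "T = Sup {T'. \<exists>y. ode_solution F x0 T' y}"
  \<comment> \<open>By uniqueness the chosen value does not depend on which solution reaching past
    \<open>t\<close> supplies it.\<close>
  define x where "x t = (SOME v. \<exists>T' y. ode_solution F x0 T' y \<and> ereal t < T' \<and> y t = v)" for t
  have le: "T' \<le> T" if "ode_solution F x0 T' y" for T' y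
    using that by (auto simp: T_def intro: Sup_upper)
  have eq: "x t = y t" if y: "ode_solution F x0 T' y" "0 \<le> t" "ereal t < T'" for T' y t
  proof -
    have "\<exists>v T' y. ode_solution F x0 T' y \<and> ereal t < T' \<and> y t = v" using y by blast
    from someI_ex[OF this] obtain T'' z
      where "ode_solution F x0 T'' z" "ereal t < T''" "z t = x t"
      unfolding x_def by blast
    then show ?thesis using ode_solution_unique[OF F, of x0 T'' z T' y t] y by simp
  qed
  obtain T1 x1 where x1: "ode_solution F x0 T1 x1"
    using ode_solution_exists[OF F] .
  then have T1: "0 < T1" by (simp add: ode_solution_def)
  have sol: "ode_solution F x0 T x"
    unfolding ode_solution_def
  proof (intro conjI allI impI)
    show "0 < T" using T1 le[OF x1] by order
    show "x 0 = x0" using eq[OF x1, of 0] x1 T1 by (simp add: ode_solution_def flip: zero_ereal_def)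
    have "(x1 \<longlongrightarrow> x0) (at_right 0)" using x1 by (simp add: ode_solution_def)
    moreover have "\<forall>\<^sub>F t in at_right 0. x1 t = x t"
    proof -
      obtain a where a: "0 < a" "ereal a < T1"
        using ereal_dense2[OF T1] by auto
      have "eventually (\<lambda>t. t \<in> {0<..<a}) (at_right 0)"
        using a by (intro eventually_at_right_real)
      then show ?thesis
      proof eventually_elim
        case (elim t)
        then have "ereal t < T1" using a by (auto intro: less_trans[of _ "ereal a"])
        with elim show ?case using eq[OF x1, of t] by simp
      qed
    qed
    ultimately show "(x \<longlongrightarrow> x0) (at_right 0)" by (rule Lim_transform_eventually)
  next
    fix t assume t: "0 < t \<and> ereal t < T"
    then obtain T' y where y: "ode_solution F x0 T' y" "ereal t < T'"
      by (auto simp: T_def less_Sup_iff)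
    then have "(y has_vector_derivative F (y t)) (at t)"
      using t by (simp add: ode_solution_def)
    then have "(x has_vector_derivative F (y t)) (at t)"
    \<comment> \<open>Near \<open>t\<close>, \<open>x\<close> agrees with the single solution
      \<open>y\<close>, so it inherits the derivative.\<close>
    proof (rule has_vector_derivative_transform_within_open[of _ _ _ "einterval 0 T'"])
      show "t \<in> einterval 0 T'" using t y by (simp add: einterval_iff)
      show "y s = x s" if "s \<in> einterval 0 T'" for s
        using eq[OF y(1), of s] that by (simp add: einterval_iff)
    qed simp
    then show "(x has_vector_derivative F (x t)) (at t)"
      using eq[OF y(1), of t] y t by simp
  qed
  have "filterlim (\<lambda>t. norm (x t)) at_top (at_left (real_of_ereal T))" if "T < \<infinity>"
  proof (rule ccontr)
    assume not_top: "\<not> ?thesis"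
    have "0 < T" using sol by (simp add: ode_solution_def)
    with that have T: "T = ereal (real_of_ereal T)" by (cases T) auto
    have sol': "ode_solution F x0 (ereal (real_of_ereal T)) x" using sol T by simp
    obtain T' y where "ereal (real_of_ereal T) < T'" "ode_solution F x0 T' y"
      using ode_solution_extend[OF F sol' ode_solution_bounded[OF F sol' not_top]] .
    then show False using le[of T' y] T by simp
  qed
  moreover have "y t = x t" if "ode_solution F x0 T' y" "0 \<le> t" "ereal t < T'" for T' y t
    using eq[OF that] by simp
  ultimately show ?thesis
    using sol le by (intro exI[of _ T] exI[of _ x] conjI allI impI) blast+
qed

section \<open>The semidiscrete problem\<close>

text \<open>Joins completeness and norm so that the sequence space can serve as the phase space of
  the theory above.\<close>

instance bcontfun :: (metric_space, banach) banach ..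


section \<open>Closure properties of functions that are Lipschitz on balls\<close>

lemma lipschitz_on_balls_linear: "bounded_linear f \<Longrightarrow> lipschitz_on_balls f"
  unfolding lipschitz_on_balls_def by (metis bounded_linear.lipschitz_boundE)

lemma lipschitz_on_balls_add:
  "lipschitz_on_balls f \<Longrightarrow> lipschitz_on_balls g \<Longrightarrow> lipschitz_on_balls (\<lambda>x. f x + g x)"
  unfolding lipschitz_on_balls_def by (blast intro: lipschitz_on_add)

lemma lipschitz_on_balls_diff:
  "lipschitz_on_balls f \<Longrightarrow> lipschitz_on_balls g \<Longrightarrow> lipschitz_on_balls (\<lambda>x. f x - g x)"
  unfolding lipschitz_on_balls_def by (blast intro: lipschitz_on_diff)

lemma lipschitz_on_balls_sum:
  "(\<And>i. i \<in> I \<Longrightarrow> lipschitz_on_balls (f i)) \<Longrightarrow> lipschitz_on_balls (\<lambda>x. \<Sum>i\<in>I. f i x)"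
proof (induction I rule: infinite_finite_induct)
  case (insert i I)
  then show ?case by (simp add: lipschitz_on_balls_add)
qed (auto simp: lipschitz_on_balls_linear bounded_linear_zero)

text \<open>A Lipschitz function maps a ball into a ball, of radius
  \<open>norm (f 0) + L * R\<close>, and \<open>g\<close> is Lipschitz there.\<close>

lemma lipschitz_on_balls_compose:
  assumes f: "lipschitz_on_balls f" and g: "lipschitz_on_balls g"
  shows "lipschitz_on_balls (\<lambda>x. g (f x))"
  unfolding lipschitz_on_balls_def
proof
  fix R
  obtain L where L: "L-lipschitz_on (cball 0 R) f" using f by (auto simp: lipschitz_on_balls_def)
  then have "L \<ge> 0" by (rule lipschitz_on_nonneg)
  define B where "B = norm (f 0) + L * R"
  have "f ` cball 0 R \<subseteq> cball 0 B"
  proof clarsimp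
    fix v :: 'a assume v: "norm v \<le> R"
    then have "0 \<le> R" using norm_ge_zero order_trans by blast
    have "norm (f v) \<le> norm (f 0) + norm (f v - f 0)"
      by (metis add.commute diff_add_cancel norm_triangle_ineq)
    also have "norm (f v - f 0) \<le> L * norm (v - 0)"
      using v \<open>0 \<le> R\<close> by (intro lipschitz_on_normD[OF L]) auto
    also have "\<dots> \<le> L * R" using v \<open>L \<ge> 0\<close> by (simp add: mult_left_mono)
    finally show "norm (f v) \<le> B" by (simp add: B_def)
  qed
  moreover obtain M where "M-lipschitz_on (cball 0 B) g"
    using g by (auto simp: lipschitz_on_balls_def)
  ultimately have "M-lipschitz_on (f ` cball 0 R) g" by (metis lipschitz_on_subset)
  then show "\<exists>K. K-lipschitz_on (cball 0 R) (\<lambda>x. g (f x))"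
    using lipschitz_on_compose2[OF L] by blast
qed

lemma lipschitz_on_balls_continuous:
  fixes f :: "'a::real_normed_vector \<Rightarrow> 'b::real_normed_vector"
  assumes f: "lipschitz_on_balls f"
  shows "continuous_on UNIV f"
  unfolding continuous_on_eq_continuous_at[OF open_UNIV]
proof
  fix v :: 'a
  obtain L where "L-lipschitz_on (cball 0 (norm v + 1)) f"
    using f by (auto simp: lipschitz_on_balls_def)
  then have "continuous_on (ball 0 (norm v + 1)) f"
    by (intro lipschitz_on_continuous_on) (auto elim: lipschitz_on_subset)
  then show "isCont f v" by (simp add: continuous_on_eq_continuous_at)
qed

text \<open>For \<open>p \<ge> 1\<close> the derivative \<open>p * x powr (p - 1)\<close> is bounded
  on \<open>(0, R)\<close> by its value at \<open>R\<close>. The mean value inequality asks for the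
  derivative only in the open interval, so the endpoint \<open>0\<close> does no harm.\<close>

lemma lipschitz_on_balls_abs_powr:
  fixes p :: real
  assumes p: "p \<ge> 1"
  shows "lipschitz_on_balls (\<lambda>x::real. \<bar>x\<bar> powr p)"
  unfolding lipschitz_on_balls_def
proof
  fix R :: real
  define M where "M = p * R powr (p - 1)"
  have M: "M \<ge> 0" using p by (simp add: M_def)
  have step: "\<bar>b powr p - a powr p\<bar> \<le> M * \<bar>b - a\<bar>" if ab: "0 \<le> a" "a < b" "b \<le> R" for a b
  proof -
    have "norm (b powr p - a powr p) \<le> M * b - M * a"
    proof (rule differentiable_bound_general[OF \<open>a < b\<close>])
      show "continuous_on {a..b} (\<lambda>x. x powr p)"
        using ab p by (intro continuous_on_powr' continuous_intros) auto
      show "continuous_on {a..b} ((*) M)" by (intro continuous_intros)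
      fix x assume x: "a < x" "x < b"
      show "((\<lambda>x. x powr p) has_vector_derivative p * x powr (p - 1)) (at x)"
        unfolding has_real_derivative_iff_has_vector_derivative[symmetric]
        using x ab by (intro has_real_derivative_powr) auto
      show "((*) M has_vector_derivative M) (at x)"
        unfolding has_real_derivative_iff_has_vector_derivative[symmetric]
        by (auto intro!: derivative_eq_intros)
      show "norm (p * x powr (p - 1)) \<le> M"
        using x ab p by (auto simp: M_def abs_mult intro!: mult_left_mono powr_mono2)
    qed
    then show ?thesis using ab by (simp add: algebra_simps)
  qed
  have nonneg: "\<bar>b powr p - a powr p\<bar> \<le> M * \<bar>b - a\<bar>" if "0 \<le> a" "0 \<le> b" "a \<le> R" "b \<le> R" for a b
    using step[of a b] step[of b a] that by (cases a b rule: linorder_cases) (auto simp: abs_minus_commute)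
  have "M-lipschitz_on (cball 0 R) (\<lambda>x. \<bar>x\<bar> powr p)"
  proof (rule lipschitz_onI)
    fix x y :: real assume "x \<in> cball 0 R" "y \<in> cball 0 R"
    then have "\<bar>\<bar>x\<bar> powr p - \<bar>y\<bar> powr p\<bar> \<le> M * \<bar>\<bar>x\<bar> - \<bar>y\<bar>\<bar>"
      by (intro nonneg) auto
    also have "\<dots> \<le> M * \<bar>x - y\<bar>" using M by (intro mult_left_mono) auto
    finally show "dist (\<bar>x\<bar> powr p) (\<bar>y\<bar> powr p) \<le> M * dist x y" by (simp add: dist_real_def)
  qed (rule M)
  then show "\<exists>L. L-lipschitz_on (cball 0 R) (\<lambda>x. \<bar>x\<bar> powr p)" by blast
qed

text \<open>The type of bounded continuous functions is only known to be complete over a metric domain, and \<open>nat\<close> is not one.\<close>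

definition coord :: "(nat discrete \<Rightarrow>\<^sub>C real) \<Rightarrow> nat \<Rightarrow> real" where
  "coord v i = apply_bcontfun v (discrete i)"

lemma bounded_linear_apply_bcontfun:
  "bounded_linear (\<lambda>v::'a::topological_space \<Rightarrow>\<^sub>C 'b::real_normed_vector. apply_bcontfun v i)"
  by (rule bounded_linear_intro[of _ 1]) (auto simp: norm_bounded)

lemma bounded_linear_coord: "bounded_linear (\<lambda>v. coord v i)"
  unfolding coord_def by (rule bounded_linear_apply_bcontfun)

lemma norm_le_coord:
  assumes "\<And>i. \<bar>coord v i\<bar> \<le> B"
  shows "norm v \<le> B"
proof (rule norm_bound)
  fix i
  show "norm (apply_bcontfun v i) \<le> B"
    using assms by (cases i) (simp add: coord_def)
qed

section \<open>Sequences supported on the interior nodes\<close>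

definition unit_seq :: "nat \<Rightarrow> nat discrete \<Rightarrow>\<^sub>C real" where
  "unit_seq j = Bcontfun (\<lambda>i. if i = discrete j then 1 else 0)"

lemma coord_unit_seq: "coord (unit_seq j) i = (if i = j then 1 else 0)"
proof -
  have "(\<lambda>i. if i = discrete j then 1 else 0) \<in> (bcontfun :: (nat discrete \<Rightarrow> real) set)"
    by (rule bcontfun_normI[of _ 1]) (auto simp: continuous_on_open_vimage open_discrete)
  then show ?thesis by (simp add: unit_seq_def coord_def Bcontfun_inverse discrete_inject)
qed

text \<open>As a finite combination of fixed vectors, it reduces limits, derivatives and Lipschitz
  bounds to the single components.\<close>

definition embed_seq :: "nat \<Rightarrow> (nat \<Rightarrow> real) \<Rightarrow> nat discrete \<Rightarrow>\<^sub>C real" where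
  "embed_seq N w = (\<Sum>j\<in>{1..N}. w j *\<^sub>R unit_seq j)"

text \<open>Extension by zero: it builds in the boundary values at \<open>0\<close> and
  \<open>N + 1\<close>.\<close>

definition interior_part :: "nat \<Rightarrow> (nat \<Rightarrow> real) \<Rightarrow> nat \<Rightarrow> real" where
  "interior_part N w i = (if i \<in> {1..N} then w i else 0)"

lemma interior_part_idem: "interior_part N (interior_part N w) = interior_part N w"
  by (auto simp: interior_part_def)

lemma coord_embed_seq: "coord (embed_seq N w) = interior_part N w"
proof
  fix i
  interpret bounded_linear "\<lambda>v::nat discrete \<Rightarrow>\<^sub>C real. coord v i" by (rule bounded_linear_coord)
  show "coord (embed_seq N w) i = interior_part N w i"
    by (simp add: embed_seq_def sum scaleR coord_unit_seq interior_part_def if_distrib cong: if_cong)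
qed

section \<open>The right-hand side as a vector field\<close>

definition rhs :: "real \<Rightarrow> real \<Rightarrow> real \<Rightarrow> (nat \<Rightarrow> real) \<Rightarrow> (nat \<Rightarrow> real) \<Rightarrow> nat \<Rightarrow> real" where
  "rhs p q h bh w j = delta_xx h w j - bh j * \<bar>delta_x h w j\<bar> powr q + \<bar>w j\<bar> powr p"

text \<open>The field only sees the interior part, so no invariance of the boundary condition has to be shown.\<close>

definition rhs_field :: "real \<Rightarrow> real \<Rightarrow> real \<Rightarrow> (nat \<Rightarrow> real) \<Rightarrow> (nat discrete \<Rightarrow>\<^sub>C real) \<Rightarrow> nat discrete \<Rightarrow>\<^sub>C real" where
  "rhs_field p q h bh v =
     embed_seq (num_nodes h) (rhs p q h bh (interior_part (num_nodes h) (coord v)))"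

text \<open>The difference quotients are bounded linear in \<open>v\<close>, since coordinates are;
  the two powers are then compositions with functions Lipschitz on balls.\<close>

lemma lipschitz_rhs_field:
  assumes "p \<ge> 1" "q \<ge> 1"
  shows "lipschitz_on_balls (rhs_field p q h bh)"
proof -
  let ?I = "\<lambda>v::nat discrete \<Rightarrow>\<^sub>C real. interior_part (num_nodes h) (coord v)"
  have lin: "bounded_linear (\<lambda>v. ?I v i)" for i
    by (cases "i \<in> {1..num_nodes h}") (auto simp: interior_part_def bounded_linear_coord bounded_linear_zero)
  have dxx: "bounded_linear (\<lambda>v. delta_xx h (?I v) j)" for j
    unfolding delta_xx_def
    by (intro bounded_linear_compose[OF bounded_linear_divide] bounded_linear_add bounded_linear_sub
        bounded_linear_const_mult lin)
  have dx: "bounded_linear (\<lambda>v. delta_x h (?I v) j)" for j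
    unfolding delta_x_def
    by (intro bounded_linear_compose[OF bounded_linear_divide] bounded_linear_sub lin)
  have "lipschitz_on_balls (\<lambda>v. rhs p q h bh (?I v) j)" for j
    unfolding rhs_def
    by (intro lipschitz_on_balls_add lipschitz_on_balls_diff lipschitz_on_balls_linear[OF dxx]
        lipschitz_on_balls_compose[OF _ lipschitz_on_balls_linear[OF bounded_linear_mult_right]]
        lipschitz_on_balls_compose[OF lipschitz_on_balls_linear[OF dx] lipschitz_on_balls_abs_powr]
        lipschitz_on_balls_compose[OF lipschitz_on_balls_linear[OF lin] lipschitz_on_balls_abs_powr]
        assms)
  then show ?thesis
    unfolding rhs_field_def embed_seq_def
    by (intro lipschitz_on_balls_sum
        lipschitz_on_balls_compose[OF _ lipschitz_on_balls_linear[OF bounded_linear_scaleR_left]])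
qed

section \<open>Equivalence of the two notions of solution\<close>

text \<open>This direction carries uniqueness over to the semidiscrete problem.\<close>

lemma semidiscrete_solution_imp_ode:
  assumes U: "semidiscrete_solution p q h bh u0 T U"
  shows "ode_solution (rhs_field p q h bh) (embed_seq (num_nodes h) u0) T
    (\<lambda>t. embed_seq (num_nodes h) (U t))"
  unfolding ode_solution_def
proof (intro conjI allI impI)
  let ?N = "num_nodes h"
  show "0 < T" using U by (simp add: semidiscrete_solution_def)
  show init: "embed_seq ?N (U 0) = embed_seq ?N u0"
    using U by (simp add: embed_seq_def semidiscrete_solution_def)
  have "((\<lambda>t. embed_seq ?N (U t)) \<longlongrightarrow> embed_seq ?N (U 0)) (at_right 0)"
    unfolding embed_seq_def
  proof (intro tendsto_sum tendsto_scaleR tendsto_const)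
    show "((\<lambda>t. U t j) \<longlongrightarrow> U 0 j) (at_right 0)" if "j \<in> {1..?N}" for j
    proof -
      have "\<forall>j\<le>?N + 1. ((\<lambda>t. U t j) \<longlongrightarrow> U 0 j) (at_right 0)"
        using U unfolding semidiscrete_solution_def by blast
      then show ?thesis using that by auto
    qed
  qed
  then show "((\<lambda>t. embed_seq ?N (U t)) \<longlongrightarrow> embed_seq ?N u0) (at_right 0)"
    by (simp add: init)
  fix t assume t: "0 < t \<and> ereal t < T"
  then have t': "t \<in> einterval 0 T" by (simp add: einterval_iff)
  \<comment> \<open>The boundary condition makes the extension by zero harmless at every index that
    the stencil of an interior node reads.\<close>
  have boundary: "interior_part ?N (U t) i = U t i" if "i \<le> ?N + 1" for i
  proof (cases "i \<in> {1..?N}")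
    case False
    with that have "i = 0 \<or> i = ?N + 1" by auto
    then show ?thesis using U t by (auto simp: interior_part_def semidiscrete_solution_def)
  qed (simp add: interior_part_def)
  have U': "((\<lambda>s. U s j) has_vector_derivative rhs p q h bh (interior_part ?N (U t)) j) (at t)"
    if j: "j \<in> {1..?N}" for j
  proof -
    have "(\<lambda>s. U s j) C1_differentiable_on einterval 0 T"
      using U j by (simp add: semidiscrete_solution_def)
    \<comment> \<open>\<open>deriv\<close> is a derivative only where one exists; the
      \<open>C1_differentiable_on\<close> condition provides it.\<close>
    then obtain D where D: "((\<lambda>s. U s j) has_vector_derivative D) (at t)"
      using t' by (auto simp: C1_differentiable_on_def)
    then have "deriv (\<lambda>s. U s j) t = D"
      by (simp add: DERIV_imp_deriv has_real_derivative_iff_has_vector_derivative)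
    moreover have "deriv (\<lambda>s. U s j) t - delta_xx h (U t) j + bh j * \<bar>delta_x h (U t) j\<bar> powr q
        = \<bar>U t j\<bar> powr p"
      using U j t' unfolding semidiscrete_solution_def by blast
    ultimately have "D = rhs p q h bh (U t) j" by (simp add: rhs_def)
    also have "\<dots> = rhs p q h bh (interior_part ?N (U t)) j"
    proof -
      have "j - 1 \<le> ?N + 1" "j \<le> ?N + 1" "j + 1 \<le> ?N + 1" using j by auto
      then show ?thesis
        unfolding rhs_def delta_xx_def delta_x_def by (simp only: boundary)
    qed
    finally show ?thesis using D by simp
  qed
  show "((\<lambda>t. embed_seq ?N (U t)) has_vector_derivative rhs_field p q h bh (embed_seq ?N (U t))) (at t)"
    unfolding rhs_field_def coord_embed_seq
    unfolding embed_seq_def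
  proof (intro has_vector_derivative_sum)
    fix j assume j: "j \<in> {1..?N}"
    show "((\<lambda>t. U t j *\<^sub>R unit_seq j) has_vector_derivative
        rhs p q h bh (interior_part ?N (interior_part ?N (U t))) j *\<^sub>R unit_seq j) (at t)"
      unfolding interior_part_idem
      by (rule bounded_linear.has_vector_derivative[OF bounded_linear_scaleR_left U'[OF j]])
  qed
qed

text \<open>This direction carries existence over. The solution is \<open>C\<^sup>1\<close> because
  its derivative is the continuous field along a continuous curve, and the boundary condition holds
  by construction of \<open>interior_part\<close>.\<close>

lemma ode_imp_semidiscrete_solution:
  assumes p: "p \<ge> 1" and q: "q \<ge> 1"
    and x: "ode_solution (rhs_field p q h bh) (embed_seq (num_nodes h) u0) T x"
  shows "semidiscrete_solution p q h bh u0 T (\<lambda>t. interior_part (num_nodes h) (coord (x t)))"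
proof -
  let ?N = "num_nodes h" and ?F = "rhs_field p q h bh"
  let ?U = "\<lambda>t. interior_part ?N (coord (x t))"
  have x': "(x has_vector_derivative ?F (x t)) (at t)" if "t \<in> einterval 0 T" for t
    using x that by (simp add: ode_solution_def einterval_iff)
  have U': "((\<lambda>t. ?U t j) has_vector_derivative coord (?F (x t)) j) (at t)"
    if t: "t \<in> einterval 0 T" for t j
  proof (cases "j \<in> {1..?N}")
    case True
    then show ?thesis
      using bounded_linear.has_vector_derivative[OF bounded_linear_coord x'[OF t]]
      by (simp add: interior_part_def)
  next
    \<comment> \<open>Outside the interior nodes both the function and the coordinate of the field
      vanish.\<close>
    case False
    then show ?thesis
      by (simp add: rhs_field_def coord_embed_seq interior_part_def del: atLeastAtMost_iff)
  qed
  have "continuous_on (einterval 0 T) x"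
    using x' by (metis continuous_at_imp_continuous_on has_vector_derivative_continuous)
  then have "continuous_on (einterval 0 T) (\<lambda>t. ?F (x t))"
    by (rule continuous_on_compose2[OF lipschitz_on_balls_continuous[OF lipschitz_rhs_field[OF p q]]]) simp
  then have contD: "continuous_on (einterval 0 T) (\<lambda>t. coord (?F (x t)) j)" for j
    by (rule bounded_linear.continuous_on[OF bounded_linear_coord])
  show ?thesis
    unfolding semidiscrete_solution_def
  proof (intro conjI allI ballI impI)
    show "0 < T" using x by (simp add: ode_solution_def)
    show "(\<lambda>t. ?U t j) C1_differentiable_on einterval 0 T" for j
      unfolding C1_differentiable_on_def
      by (intro exI[of _ "\<lambda>t. coord (?F (x t)) j"] conjI ballI U' contD)
    show "?U 0 j = u0 j" if "j \<in> {1..?N}" for j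
      using x that by (simp add: ode_solution_def coord_embed_seq interior_part_def)
    show "((\<lambda>t. ?U t j) \<longlongrightarrow> ?U 0 j) (at_right 0)" for j
    proof -
      have "((\<lambda>t. coord (x t) j) \<longlongrightarrow> coord (x 0) j) (at_right 0)"
        using x by (intro bounded_linear.tendsto[OF bounded_linear_coord])
          (simp add: ode_solution_def)
      then show ?thesis
        by (cases "j \<in> {1..?N}") (simp_all add: interior_part_def del: atLeastAtMost_iff)
    qed
    show "deriv (\<lambda>s. ?U s j) t - delta_xx h (?U t) j + bh j * \<bar>delta_x h (?U t) j\<bar> powr q
        = \<bar>?U t j\<bar> powr p" if t: "t \<in> einterval 0 T" and j: "j \<in> {1..?N}" for t j
    proof -
      have "deriv (\<lambda>s. ?U s j) t = coord (?F (x t)) j"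
        using U'[OF t] by (simp add: DERIV_imp_deriv has_real_derivative_iff_has_vector_derivative)
      also have "\<dots> = rhs p q h bh (?U t) j"
        using j by (simp add: rhs_field_def coord_embed_seq interior_part_def[of _ "rhs _ _ _ _ _"])
      finally show ?thesis by (simp add: rhs_def)
    qed
  qed (auto simp: interior_part_def)
qed

text \<open>This inequality transfers blow-up from the sequence space to the grid.\<close>

lemma norm_embed_seq_le_grid_norm: "norm (embed_seq (num_nodes h) w) \<le> grid_norm h w"
proof (rule norm_le_coord)
  fix i
  have le: "\<bar>w i\<bar> \<le> grid_norm h w" if "i \<le> num_nodes h + 1" for i
    using that unfolding grid_norm_def by (intro Max_ge) auto
  have "0 \<le> \<bar>w 0\<bar>" by simp
  also have "\<dots> \<le> grid_norm h w" by (intro le) simp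
  finally show "\<bar>coord (embed_seq (num_nodes h) w) i\<bar> \<le> grid_norm h w"
    using le[of i] by (auto simp: coord_embed_seq interior_part_def)
qed

text \<open>The ODE solution is transported to the grid and shown to extend every semidiscrete
  solution. The divergence clause identifies a finite \<open>T\<close> as the time up to which the
  grid norm stays finite.\<close>

theorem theorem2p2:
  fixes p q h :: real and b :: "real \<Rightarrow> real" and bh u0 :: "nat \<Rightarrow> real"
  assumes "p > 1" and "1 < q" and "q \<le> 2 * p / (p + 1)" and "h > 0"
    and "continuous_on UNIV b" and "\<And>x. 0 < b x" and "bounded (range b)"
    and "\<And>j. j \<in> {1..num_nodes h} \<Longrightarrow> 0 < bh j \<and> bh j \<le> sup_norm b"
    and "\<And>j. j \<in> {1..num_nodes h} \<Longrightarrow> 0 \<le> u0 j"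
  shows "\<exists>T U. maximal_solution p q h bh u0 T U \<and>
           (T < \<infinity> \<longrightarrow> filterlim (\<lambda>t. grid_norm h (U t)) at_top (at_left (real_of_ereal T))) \<and>
           (\<forall>T' V. maximal_solution p q h bh u0 T' V \<longrightarrow> T' = T \<and> agree_on h T U V)"
proof -
  let ?N = "num_nodes h" and ?F = "rhs_field p q h bh"
  have pq: "p \<ge> 1" "q \<ge> 1" using assms(1,2) by auto
  obtain T x where x: "ode_solution ?F (embed_seq ?N u0) T x"
    and max: "\<forall>T' y. ode_solution ?F (embed_seq ?N u0) T' y \<longrightarrow>
      T' \<le> T \<and> (\<forall>t. 0 \<le> t \<and> ereal t < T' \<longrightarrow> y t = x t)"
    and blowup: "T < \<infinity> \<longrightarrow> filterlim (\<lambda>t. norm (x t)) at_top (at_left (real_of_ereal T))"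
    using ode_maximal_solution[OF lipschitz_rhs_field[OF pq, of h bh], of "embed_seq ?N u0"] by blast
  define U where "U t = interior_part ?N (coord (x t))" for t
  have U: "semidiscrete_solution p q h bh u0 T U"
    unfolding U_def by (rule ode_imp_semidiscrete_solution[OF pq x])
  have le_T: "T' \<le> T" and agree: "agree_on h T' V U"
    if V: "semidiscrete_solution p q h bh u0 T' V" for T' V
  proof -
    note ode = semidiscrete_solution_imp_ode[OF V]
    show "T' \<le> T" using max ode by blast
    show "agree_on h T' V U"
      unfolding agree_on_def
    proof (intro allI impI)
      fix t j assume t: "0 \<le> t \<and> ereal t < T'" and j: "j \<le> ?N + 1"
      \<comment> \<open>This settles the interior nodes; at \<open>0\<close> and
        \<open>N + 1\<close> both sides vanish, \<open>V\<close> by its boundary condition and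
        \<open>U\<close> by construction.\<close>
      have "embed_seq ?N (V t) = x t" using max ode t by blast
      then have "U t = interior_part ?N (interior_part ?N (V t))"
        by (metis U_def coord_embed_seq)
      then have "U t = interior_part ?N (V t)" by (simp add: interior_part_idem)
      moreover have "V t 0 = 0" "V t (?N + 1) = 0"
        using V t by (auto simp: semidiscrete_solution_def)
      moreover have "j \<in> {1..?N} \<or> j = 0 \<or> j = ?N + 1" using j by auto
      ultimately show "V t j = U t j" by (auto simp: interior_part_def)
    qed
  qed
  have "maximal_solution p q h bh u0 T U"
    unfolding maximal_solution_def using U le_T by (meson not_le)
  moreover have "filterlim (\<lambda>t. grid_norm h (U t)) at_top (at_left (real_of_ereal T))" if "T < \<infinity>"
  proof (rule filterlim_at_top_mono[OF blowup[rule_format, OF that]])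
    have "0 < T" using x by (simp add: ode_solution_def)
    with that have T: "T = ereal (real_of_ereal T)" by (cases T) auto
    then have "0 < real_of_ereal T" using \<open>0 < T\<close> by (metis ereal_less(2))
    then have "eventually (\<lambda>t. t \<in> {0<..<real_of_ereal T}) (at_left (real_of_ereal T))"
      by (rule eventually_at_left_real)
    then show "\<forall>\<^sub>F t in at_left (real_of_ereal T). norm (x t) \<le> grid_norm h (U t)"
    proof eventually_elim
      case (elim t)
      then have "ereal t < T" by (subst T) simp
      \<comment> \<open>Embedding \<open>U\<close> gives a solution of the same initial value
        problem, so by uniqueness passing to the interior part has lost nothing of
        \<open>x\<close>.\<close>
      then have "embed_seq ?N (U t) = x t"
        using max semidiscrete_solution_imp_ode[OF U] elim by (meson greaterThanLessThan_iff less_imp_le)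
      then show ?case using norm_embed_seq_le_grid_norm by metis
    qed
  qed
  moreover have "T' = T \<and> agree_on h T U V" if V: "maximal_solution p q h bh u0 T' V" for T' V
  proof -
    have V': "semidiscrete_solution p q h bh u0 T' V" using V by (simp add: maximal_solution_def)
    \<comment> \<open>Otherwise \<open>U\<close> would be a proper extension of \<open>V\<close>,
      against the maximality of \<open>V\<close>.\<close>
    have "\<not> T' < T" using V U agree[OF V'] unfolding maximal_solution_def by blast
    then have "T' = T" using le_T[OF V'] by simp
    then show ?thesis using agree[OF V'] by (simp add: agree_on_def)
  qed
  ultimately show ?thesis by blast
qed

end
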